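(* Assume that $\psi$ has an $L_\psi$-Lipschitz continuous gradient and that each $f_i$, $i\in[m]$, is $\mu_f$-strongly convex with modulus $\mu_f>0$. Let $\hat x$ be the unique solution of the bilevel problem $$\min_{x\in\mathbb{R}^n}\psi(x)\quad\text{s.t.}\quad x\in\bar X=\arg\min_{x\in\mathbb{R}^n}F(x).$$ Let $\{x_k\}_{k\ge0}$ be generated by the stochastic block Bregman projection (SBBP) method with stepsize $t_k\in\left(0,\frac{\mu}{L_{\max}}\right]$. Then the sequence $\{x_k\}_{k\ge0}$ converges in expectation to the unique solution $\hat x$ of the bilevel problem with a linear rate $$\mathbb{E}\,D_\psi(x_{k+1},\hat x)\le\left(1-\frac{\mu_f}{L_\psi}t_k\right)\mathbb{E}\,D_\psi(x_k,\hat x).$$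
   Context: Notation: $[m]=\{1,\dots,m\}$; $\|\cdot\|$ is the Euclidean norm. $C_1,\dots,C_m\subset\mathbb{R}^n$ are closed convex sets with $C=\bigcap_{i=1}^mC_i\ne\emptyset$. Standing assumptions: $\psi:\mathbb{R}^n\to\mathbb{R}$ is $\mu$-strongly convex ($\mu>0$); each $f_i:\mathbb{R}^n\to\mathbb{R}$, $i\in[m]$, is convex and differentiable with $L_i$-Lipschitz gradient, $L_i>0$, and satisfies $f_i(x)\ge0$ for all $x$, with $f_i(x)=0$ if and only if $x\in C_i$; $L_{\max}=\max_{i\in[m]}L_i$; $F(x)=\sum_{i=1}^m\mathbf P(i)f_i(x)$ with $\mathbf P(i)>0$, $\sum_{i\in[m]}\mathbf P(i)=1$, and $\bar X=\arg\min_{x\in\mathbb{R}^n}F(x)\neq\emptyset$. $\psi^*$ is the Fenchel conjugate of $\psi$. For differentiable $\psi$, $D_\psi(x,y)=\psi(y)-\psi(x)-\langle\nabla\psi(x),y-x\rangle$. SBBP method: choose $x_0\in\mathbb{R}^n$ and $x_0^*\in\partial\psi(x_0)$ ($=\{\nabla\psi(x_0)\}$ here). At each iteration $k\ge0$ a random nonempty subset $J_k\subseteq[m]$ is drawn from the sampling distribution, then the stepsize $t_k$ is updated according to the chosen rule, and, with weights $w_{i,k}>0$, $\sum_{i\in J_k}w_{i,k}=1$, $$x_{k+1}^*=x_k^*-t_k\sum_{i\in J_k}w_{i,k}\nabla f_i(x_k),\qquad x_{k+1}=\nabla\psi^*(x_{k+1}^* ).$$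
   Formalization: Convergence in expectation is claimed only when the stepsizes t_k have divergent sum, and a uniform geometric rate only when t_k is bounded below by a positive constant; for summable t_k convergence can fail. The one-step inequality holds for all allowed t_k. *)

theory Defs
  imports "HOL-Probability.Probability"
begin

(* Only meaningful at points where f is differentiable, where the gradient exists and is unique. *)
definition grad :: "('a::real_inner \<Rightarrow> real) \<Rightarrow> 'a \<Rightarrow> 'a" where
  "grad f x = (THE D. GDERIV f x :> D)"

definition strongly_convex :: "real \<Rightarrow> ('a::real_inner \<Rightarrow> real) \<Rightarrow> bool" where
  "strongly_convex \<mu> f \<longleftrightarrow>
     (\<forall>x y. \<forall>u\<in>{0..1}.
        f ((1 - u) *\<^sub>R x + u *\<^sub>R y)
          \<le> (1 - u) * f x + u * f y - \<mu> / 2 * u * (1 - u) * (norm (x - y))\<^sup>2)"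

definition subdifferential :: "('a::real_inner \<Rightarrow> real) \<Rightarrow> 'a \<Rightarrow> 'a set" where
  "subdifferential f x = {g. \<forall>y. f x + g \<bullet> (y - x) \<le> f y}"

(* A real-valued supremum: it is the true conjugate only where the set is bounded above.
   For a finite strongly convex f on a Euclidean space this holds at every point. *)
definition fenchel_conjugate :: "('a::real_inner \<Rightarrow> real) \<Rightarrow> 'a \<Rightarrow> real" where
  "fenchel_conjugate f y = (SUP x. y \<bullet> x - f x)"

(* The base point of the linearisation is the first argument. *)
definition bregman :: "('a::real_inner \<Rightarrow> real) \<Rightarrow> 'a \<Rightarrow> 'a \<Rightarrow> real" where
  "bregman \<psi> x y = \<psi> y - \<psi> x - grad \<psi> x \<bullet> (y - x)"

definition argmin_set :: "('a \<Rightarrow> real) \<Rightarrow> 'a set" where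
  "argmin_set F = {x. is_arg_min F (\<lambda>_. True) x}"

definition bilevel_solution :: "('a \<Rightarrow> real) \<Rightarrow> ('a \<Rightarrow> real) \<Rightarrow> 'a \<Rightarrow> bool" where
  "bilevel_solution \<psi> F x \<longleftrightarrow> is_arg_min \<psi> (\<lambda>y. y \<in> argmin_set F) x"

end

theory Submission
  imports Defs
begin

text \<open>
  The intersection of the \<open>C\<^sub>i\<close> is the zero set of \<open>F\<close>, and strong convexity of
  the \<open>f\<^sub>i\<close> shrinks it to a single point \<open>c\<close>, which is therefore the bilevel solution. The mirror
  relation \<open>xs k = \<nabla>\<psi> (x k)\<close> persists because \<open>\<nabla>\<psi>\<^sup>*\<close> inverts \<open>\<nabla>\<psi>\<close>. One step with direction
  \<open>g = \<Sum> w\<^sub>i \<nabla>f\<^sub>i (x)\<close> then satisfies the three-point identity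
  \<open>D (x, c) - D (x', c) = D (x, x') + t \<langle>g, x' - x\<rangle> + t \<langle>g, x - c\<rangle>\<close>.
  Since \<open>t L\<^sub>i \<le> \<mu>\<close>, the descent lemma bounds the first two terms below by
  \<open>t \<Sum> w\<^sub>i (f\<^sub>i (x') - f\<^sub>i (x))\<close>, while strong convexity bounds the last one below by
  \<open>t \<Sum> w\<^sub>i f\<^sub>i (x) + t \<mu>\<^sub>f / 2 \<parallel>x - c\<parallel>\<^sup>2\<close>. As \<open>D (x, c) \<le> L\<^sub>\<psi> / 2 \<parallel>x - c\<parallel>\<^sup>2\<close>, the distance
  contracts along every sample path, and it remains to take expectations.
\<close>

section \<open>Gradients and restrictions to lines\<close>

lemma grad_eqI:
  assumes "GDERIV f x :> D"
  shows "grad f x = D"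
  unfolding grad_def
proof (rule the_equality)
  show "GDERIV f x :> D" by fact
next
  fix E assume "GDERIV f x :> E"
  then have "(\<lambda>h. inner h E) = (\<lambda>h. inner h D)"
    using assms unfolding gderiv_def by (rule has_derivative_unique)
  then show "E = D"
    by (metis inner_commute vector_eq_rdot)
qed

lemma GDERIV_grad:
  fixes f :: "'a::euclidean_space \<Rightarrow> real"
  assumes "f differentiable (at x)"
  shows "GDERIV f x :> grad f x"
proof -
  obtain f' where f': "(f has_derivative f') (at x)"
    using assms by (auto simp: differentiable_def)
  then have "linear f'" by (rule has_derivative_linear)
  \<comment> \<open>\<open>adjoint f' 1\<close> is the Riesz representative of the functional
    \<open>f'\<close>.\<close>
  then have "f' = (\<lambda>h. inner h (adjoint f' 1))"
    by (simp add: adjoint_works)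
  with f' have "GDERIV f x :> adjoint f' 1"
    unfolding gderiv_def by metis
  then show ?thesis using grad_eqI by metis
qed

lemma has_real_derivative_along_line:
  fixes f :: "'a::euclidean_space \<Rightarrow> real"
  assumes "f differentiable (at (x + s *\<^sub>R d))"
  shows "((\<lambda>s. f (x + s *\<^sub>R d)) has_real_derivative grad f (x + s *\<^sub>R d) \<bullet> d) (at s)"
proof -
  have "(f has_derivative (\<lambda>h. h \<bullet> grad f (x + s *\<^sub>R d))) (at (x + s *\<^sub>R d))"
    using GDERIV_grad[OF assms] by (simp add: gderiv_def)
  moreover have "((\<lambda>s. x + s *\<^sub>R d) has_derivative (\<lambda>h. h *\<^sub>R d)) (at s)"
    by (auto intro!: derivative_eq_intros)
  ultimately have "((\<lambda>s. f (x + s *\<^sub>R d)) has_derivative (\<lambda>h. (h *\<^sub>R d) \<bullet> grad f (x + s *\<^sub>R d))) (at s)"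
    by (rule has_derivative_compose[rotated])
  then show ?thesis
    unfolding has_field_derivative_def
    by (rule has_derivative_eq_rhs) (auto simp: inner_commute mult.commute)
qed

section \<open>Quadratic bounds on the Bregman distance\<close>

text \<open>The descent lemma. Up to rearrangement the claim is
  \<open>\<phi> 0 \<le> \<phi> 1\<close>, and on the unit interval \<open>\<phi>'\<close> is
  nonnegative by Cauchy-Schwarz and the Lipschitz bound on the gradient.\<close>

lemma bregman_le_if_lipschitz_grad:
  fixes f :: "'a::euclidean_space \<Rightarrow> real"
  assumes diff: "\<And>z. f differentiable (at z)" and lip: "L-lipschitz_on UNIV (grad f)"
  shows "bregman f x y \<le> L / 2 * (norm (y - x))\<^sup>2"
proof -
  define d where "d = y - x"
  define \<phi> where "\<phi> s = L / 2 * s\<^sup>2 * (norm d)\<^sup>2 + s * (grad f x \<bullet> d) - f (x + s *\<^sub>R d)" for s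
  define \<phi>' where "\<phi>' s = L * s * (norm d)\<^sup>2 + grad f x \<bullet> d - grad f (x + s *\<^sub>R d) \<bullet> d" for s
  have "\<phi> 0 \<le> \<phi> 1"
  proof (rule DERIV_nonneg_imp_nondecreasing[where f = \<phi>])
    fix s :: real assume s: "0 \<le> s" "s \<le> 1"
    have der: "(\<phi> has_real_derivative \<phi>' s) (at s)"
      unfolding \<phi>_def[abs_def] \<phi>'_def
      by (auto intro!: derivative_eq_intros has_real_derivative_along_line diff)
    have "(grad f (x + s *\<^sub>R d) - grad f x) \<bullet> d \<le> norm (grad f (x + s *\<^sub>R d) - grad f x) * norm d"
      by (rule norm_cauchy_schwarz)
    also have "\<dots> \<le> (L * norm (s *\<^sub>R d)) * norm d"
      using lipschitz_onD[OF lip, of "x + s *\<^sub>R d" x] by (intro mult_right_mono) (auto simp: dist_norm)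
    also have "\<dots> = L * s * (norm d)\<^sup>2"
      using s by (simp add: power2_eq_square)
    finally have "0 \<le> \<phi>' s"
      by (simp add: \<phi>'_def inner_diff_left)
    with der show "\<exists>y. DERIV \<phi> s :> y \<and> 0 \<le> y" by blast
  qed simp
  then show ?thesis
    by (simp add: \<phi>_def bregman_def d_def)
qed

text \<open>The defining inequality, divided by \<open>s\<close>, bounds the difference quotient of
  \<open>f\<close> from \<open>x\<close> towards \<open>y\<close>; letting \<open>s\<close> tend to
  0 from the right turns the quotient into the directional derivative.\<close>

lemma bregman_ge_if_strongly_convex:
  fixes f :: "'a::euclidean_space \<Rightarrow> real"
  assumes diff: "f differentiable (at x)" and sc: "strongly_convex \<mu> f"
  shows "\<mu> / 2 * (norm (y - x))\<^sup>2 \<le> bregman f x y"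
proof -
  define d where "d = y - x"
  have "((\<lambda>s. f (x + s *\<^sub>R d)) has_real_derivative grad f x \<bullet> d) (at 0)"
    using has_real_derivative_along_line[of f x 0 d] diff by simp
  then have "((\<lambda>s. (f (x + s *\<^sub>R d) - f x) / s) \<longlongrightarrow> grad f x \<bullet> d) (at 0)"
    by (simp add: has_field_derivative_iff)
  then have lhs: "((\<lambda>s. (f (x + s *\<^sub>R d) - f x) / s) \<longlongrightarrow> grad f x \<bullet> d) (at_right 0)"
    by (rule tendsto_mono[rotated]) (simp add: at_le)
  have rhs: "((\<lambda>s. f y - f x - \<mu> / 2 * (1 - s) * (norm d)\<^sup>2)
      \<longlongrightarrow> f y - f x - \<mu> / 2 * (1 - 0) * (norm d)\<^sup>2) (at_right 0)"
    by (intro tendsto_intros)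
  have "(f (x + s *\<^sub>R d) - f x) / s \<le> f y - f x - \<mu> / 2 * (1 - s) * (norm d)\<^sup>2"
    if "0 < s" "s < 1" for s
  proof -
    have "f ((1 - s) *\<^sub>R x + s *\<^sub>R y) \<le> (1 - s) * f x + s * f y - \<mu> / 2 * s * (1 - s) * (norm (x - y))\<^sup>2"
      using sc that unfolding strongly_convex_def by auto
    moreover have "(1 - s) *\<^sub>R x + s *\<^sub>R y = x + s *\<^sub>R d"
      by (simp add: d_def algebra_simps)
    ultimately have "f (x + s *\<^sub>R d) - f x \<le> s * (f y - f x - \<mu> / 2 * (1 - s) * (norm d)\<^sup>2)"
      by (simp add: d_def norm_minus_commute algebra_simps)
    then show ?thesis
      using that by (simp add: pos_divide_le_eq mult.commute)
  qed
  then have "\<forall>\<^sub>F s in at_right 0. (f (x + s *\<^sub>R d) - f x) / s \<le> f y - f x - \<mu> / 2 * (1 - s) * (norm d)\<^sup>2"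
    unfolding eventually_at_right_field by (intro exI[of _ 1]) auto
  from tendsto_le[OF _ rhs lhs this] show ?thesis
    by (simp add: bregman_def d_def)
qed

lemma modulus_le_lipschitz_constant:
  fixes f :: "'a::euclidean_space \<Rightarrow> real"
  assumes diff: "\<And>z. f differentiable (at z)" and lip: "L-lipschitz_on UNIV (grad f)"
    and sc: "strongly_convex \<mu> f"
  shows "\<mu> \<le> L"
proof -
  obtain b :: 'a where "b \<in> Basis" using nonempty_Basis by blast
  then have "norm b = 1" by simp
  then show ?thesis
    using bregman_ge_if_strongly_convex[OF diff sc, of b 0]
      bregman_le_if_lipschitz_grad[OF diff lip, of 0 b] by simp
qed

section \<open>Subgradients and the Fenchel conjugate\<close>

text \<open>A subgradient \<open>g\<close> makes \<open>x\<close> a global minimiser of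
  \<open>f z - z \<bullet> g\<close>, so the derivative of that function vanishes at
  \<open>x\<close>.\<close>

lemma subdifferential_eq_grad:
  fixes f :: "'a::euclidean_space \<Rightarrow> real"
  assumes diff: "f differentiable (at x)" and g: "g \<in> subdifferential f x"
  shows "grad f x = g"
proof -
  have "((\<lambda>z. f z - z \<bullet> g) has_derivative (\<lambda>h. h \<bullet> grad f x - h \<bullet> g)) (at x)"
    using GDERIV_grad[OF diff] unfolding gderiv_def by (auto intro!: derivative_eq_intros)
  moreover have "f x - x \<bullet> g \<le> f z - z \<bullet> g" for z
  proof -
    have "f x + g \<bullet> (z - x) \<le> f z"
      using g by (simp add: subdifferential_def)
    then show ?thesis
      by (simp add: inner_diff_right inner_commute[of g])
  qed
  ultimately have "(\<lambda>h. h \<bullet> grad f x - h \<bullet> g) = (\<lambda>h. 0)"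
    by (intro differential_zero_maxmin[of x UNIV]) auto
  then have "(grad f x - g) \<bullet> (grad f x - g) = 0"
    by (metis inner_diff_right)
  then show ?thesis by simp
qed

text \<open>A global minimiser of the tilted function \<open>h\<close> has \<open>y\<close> as a
  subgradient of \<open>f\<close>. It exists because strong convexity makes \<open>h\<close>
  coercive, which reduces the search to a compact ball.\<close>

lemma ex_subgradient_preimage:
  fixes f :: "'a::euclidean_space \<Rightarrow> real"
  assumes \<mu>: "\<mu> > 0" and sc: "strongly_convex \<mu> f" and diff: "\<And>z. f differentiable (at z)"
  shows "\<exists>z. y \<in> subdifferential f z"
proof -
  define h where "h z = f z - y \<bullet> z" for z
  define a where "a = grad f 0 - y"
  \<comment> \<open>Beyond this radius the growth \<open>\<mu> / 2 * (norm v)\<^sup>2\<close>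
    dominates the linear term, which is at least \<open>- (norm a * norm v)\<close>, so
    \<open>h\<close> is no smaller there than at 0.\<close>
  define R where "R = 2 * norm a / \<mu>"
  have "continuous_on UNIV f"
    using diff by (simp add: continuous_on_eq_continuous_at differentiable_imp_continuous_within)
  then have "continuous_on (cball 0 R) h"
    unfolding h_def[abs_def] by (auto intro!: continuous_intros intro: continuous_on_subset)
  moreover have "0 \<le> R" using \<mu> by (simp add: R_def)
  ultimately obtain z where z: "z \<in> cball 0 R" "\<And>v. v \<in> cball 0 R \<Longrightarrow> h z \<le> h v"
    using continuous_attains_inf[of "cball 0 R" h] by auto
  have "h z \<le> h v" for v
  proof (cases "v \<in> cball 0 R")
    case False
    then have v: "norm a \<le> \<mu> / 2 * norm v"
      using \<mu> by (simp add: R_def field_simps)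
    have "- (norm a * norm v) \<le> a \<bullet> v"
      using Cauchy_Schwarz_ineq2[of a v] by linarith
    moreover have "norm a * norm v \<le> \<mu> / 2 * (norm v)\<^sup>2"
      using mult_right_mono[OF v, of "norm v"] by (simp add: power2_eq_square)
    moreover have "\<mu> / 2 * (norm v)\<^sup>2 \<le> f v - f 0 - grad f 0 \<bullet> v"
      using bregman_ge_if_strongly_convex[OF diff sc, of v 0] by (simp add: bregman_def)
    ultimately have "h 0 \<le> h v"
      by (simp add: h_def a_def inner_diff_left)
    moreover have "h z \<le> h 0" using z(2) \<open>0 \<le> R\<close> by simp
    ultimately show ?thesis by linarith
  qed (use z in auto)
  then have "y \<in> subdifferential f z"
    by (simp add: subdifferential_def h_def inner_diff_right algebra_simps)
  then show ?thesis ..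
qed

text \<open>Differentiability of the conjugate has to be established along the way. With
  \<open>grad f z = y\<close>, the conjugate lies between the affine function
  \<open>v \<bullet> z - f z\<close> and the same function plus a quadratic in \<open>v - y\<close>;
  hence it is differentiable at \<open>y\<close> with gradient \<open>z\<close>.\<close>

lemma grad_grad_fenchel_conjugate:
  fixes f :: "'a::euclidean_space \<Rightarrow> real"
  assumes \<mu>: "\<mu> > 0" and sc: "strongly_convex \<mu> f" and diff: "\<And>z. f differentiable (at z)"
  shows "grad f (grad (fenchel_conjugate f) y) = y"
proof -
  let ?g = "fenchel_conjugate f"
  obtain z where "y \<in> subdifferential f z"
    using ex_subgradient_preimage[OF \<mu> sc diff] by blast
  then have z: "grad f z = y"
    using subdifferential_eq_grad diff by blast
  have upper: "v \<bullet> p - f p \<le> y \<bullet> z - f z + (v - y) \<bullet> z + (norm (v - y))\<^sup>2 / (2 * \<mu>)" for v p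
  proof -
    have "\<mu> / 2 * (norm (p - z))\<^sup>2 \<le> f p - f z - y \<bullet> (p - z)"
      using bregman_ge_if_strongly_convex[OF diff sc, of p z] by (simp add: bregman_def z)
    moreover have "(v - y) \<bullet> (p - z) \<le> \<mu> / 2 * (norm (p - z))\<^sup>2 + (norm (v - y))\<^sup>2 / (2 * \<mu>)"
    proof -
      have "(v - y) \<bullet> (p - z) \<le> norm (v - y) * norm (p - z)"
        by (rule norm_cauchy_schwarz)
      \<comment> \<open>Expanding this square gives Young's inequality with the weight that cancels
        the strong convexity term.\<close>
      moreover have "0 \<le> (\<mu> * norm (p - z) - norm (v - y))\<^sup>2 / (2 * \<mu>)"
        using \<mu> by simp
      then have "norm (v - y) * norm (p - z) \<le> \<mu> / 2 * (norm (p - z))\<^sup>2 + (norm (v - y))\<^sup>2 / (2 * \<mu>)"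
        using \<mu> by (simp add: power2_diff field_simps power2_eq_square)
      ultimately show ?thesis by linarith
    qed
    ultimately show ?thesis
      by (simp add: inner_diff_left inner_diff_right algebra_simps)
  qed
  \<comment> \<open>Boundedness ensures that the real-valued \<open>SUP\<close> is the true
    conjugate at \<open>v\<close>.\<close>
  have bdd: "bdd_above (range (\<lambda>p. v \<bullet> p - f p))" for v
    using upper[of v] by (intro bdd_aboveI2)
  have ge: "v \<bullet> z - f z \<le> ?g v" for v
    unfolding fenchel_conjugate_def by (rule cSUP_upper[OF _ bdd]) simp
  have le: "?g v \<le> y \<bullet> z - f z + (v - y) \<bullet> z + (norm (v - y))\<^sup>2 / (2 * \<mu>)" for v
    unfolding fenchel_conjugate_def by (rule cSUP_least) (use upper in auto)
  have gy: "?g y = y \<bullet> z - f z"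
    using ge[of y] le[of y] by simp
  have "GDERIV ?g y :> z"
    unfolding gderiv_def has_derivative_at
  proof (intro conjI)
    show "bounded_linear (\<lambda>h. h \<bullet> z)" by (rule bounded_linear_inner_left)
    have lim: "(\<lambda>h::'a. norm h / (2 * \<mu>)) \<midarrow>0\<rightarrow> 0"
      by (intro tendsto_divide_zero tendsto_norm_zero tendsto_ident_at)
    have "norm (norm (?g (y + h) - ?g y - h \<bullet> z) / norm h) \<le> norm h / (2 * \<mu>)" for h
    proof -
      have "\<bar>?g (y + h) - ?g y - h \<bullet> z\<bar> \<le> (norm h)\<^sup>2 / (2 * \<mu>)"
        using ge[of "y + h"] le[of "y + h"] gy \<mu> by (simp add: inner_add_left abs_le_iff)
      then show ?thesis
        by (cases "h = 0") (use \<mu> in \<open>auto simp: field_simps power2_eq_square\<close>)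
    qed
    then show "(\<lambda>h. norm (?g (y + h) - ?g y - h \<bullet> z) / norm h) \<midarrow>0\<rightarrow> 0"
      by (intro Lim_null_comparison[OF always_eventually lim]) blast
  qed
  then show ?thesis
    by (simp add: grad_eqI z)
qed

text \<open>Adding the strong convexity bounds in both directions shows that \<open>grad f\<close>
  is strongly monotone, which for its right inverse is a Lipschitz bound. The resulting continuity
  serves the measurability of the iterates.\<close>

lemma lipschitz_grad_fenchel_conjugate:
  fixes f :: "'a::euclidean_space \<Rightarrow> real"
  assumes \<mu>: "\<mu> > 0" and sc: "strongly_convex \<mu> f" and diff: "\<And>z. f differentiable (at z)"
  shows "(1 / \<mu>)-lipschitz_on UNIV (grad (fenchel_conjugate f))"
proof (rule lipschitz_onI)
  fix u v :: 'a
  define p where "p = grad (fenchel_conjugate f) u"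
  define q where "q = grad (fenchel_conjugate f) v"
  have pq: "grad f p = u" "grad f q = v"
    unfolding p_def q_def by (rule grad_grad_fenchel_conjugate[OF \<mu> sc diff])+
  have "\<mu> * (norm (p - q))\<^sup>2 \<le> bregman f p q + bregman f q p"
    using bregman_ge_if_strongly_convex[OF diff sc, of q p]
      bregman_ge_if_strongly_convex[OF diff sc, of p q] by (simp add: norm_minus_commute)
  also have "\<dots> = (u - v) \<bullet> (p - q)"
    by (simp add: bregman_def pq inner_diff_left inner_diff_right)
  also have "\<dots> \<le> norm (u - v) * norm (p - q)"
    by (rule norm_cauchy_schwarz)
  finally have "\<mu> * norm (p - q) \<le> norm (u - v)"
    by (cases "p = q") (auto simp: power2_eq_square)
  then show "dist (grad (fenchel_conjugate f) u) (grad (fenchel_conjugate f) v) \<le> 1 / \<mu> * dist u v"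
    using \<mu> by (simp add: dist_norm p_def q_def field_simps)
qed (use \<mu> in simp)

section \<open>One step along a fixed sample path\<close>

lemma bregman_three_point:
  "bregman f x z - bregman f y z = bregman f x y + (grad f x - grad f y) \<bullet> (y - z)"
  by (simp add: bregman_def inner_diff_left inner_diff_right)

text \<open>The estimate is made for each index separately and then averaged with the weights, which
  works because all \<open>f i\<close> vanish at the same point \<open>c\<close>.\<close>

lemma bregman_projection_step:
  fixes \<psi> :: "'a::euclidean_space \<Rightarrow> real" and f :: "'i \<Rightarrow> 'a \<Rightarrow> real"
  assumes psi: "strongly_convex \<mu> \<psi>" "\<And>z. \<psi> differentiable (at z)"
    and psi_lip: "L\<^sub>\<psi>-lipschitz_on UNIV (grad \<psi>)" "L\<^sub>\<psi> > 0"
    and f_diff: "\<And>i z. i \<in> I \<Longrightarrow> f i differentiable (at z)"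
    and f_lip: "\<And>i. i \<in> I \<Longrightarrow> (L i)-lipschitz_on UNIV (grad (f i))"
    and f_sc: "\<mu>\<^sub>f \<ge> 0" "\<And>i. i \<in> I \<Longrightarrow> strongly_convex \<mu>\<^sub>f (f i)"
    and f_nonneg: "\<And>i z. i \<in> I \<Longrightarrow> f i z \<ge> 0"
    and c: "\<And>i. i \<in> I \<Longrightarrow> f i c = 0"
    and w: "\<And>i. i \<in> I \<Longrightarrow> w i \<ge> 0" "(\<Sum>i\<in>I. w i) = 1"
    and t: "t \<ge> 0" "\<And>i. i \<in> I \<Longrightarrow> t * L i \<le> \<mu>"
    and step: "grad \<psi> y = grad \<psi> x - t *\<^sub>R (\<Sum>i\<in>I. w i *\<^sub>R grad (f i) x)"
  shows "bregman \<psi> y c \<le> (1 - \<mu>\<^sub>f / L\<^sub>\<psi> * t) * bregman \<psi> x c"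
proof -
  let ?g = "\<Sum>i\<in>I. w i *\<^sub>R grad (f i) x"
  have term_ge: "t * (\<mu>\<^sub>f / 2 * (norm (x - c))\<^sup>2)
      \<le> \<mu> / 2 * (norm (y - x))\<^sup>2 + t * (grad (f i) x \<bullet> (y - c))" if i: "i \<in> I" for i
  proof -
    have "f i y - f i x - grad (f i) x \<bullet> (y - x) \<le> L i / 2 * (norm (y - x))\<^sup>2"
      using bregman_le_if_lipschitz_grad[OF f_diff f_lip, OF i i, of x y] by (simp add: bregman_def)
    then have "- f i x \<le> L i / 2 * (norm (y - x))\<^sup>2 + grad (f i) x \<bullet> (y - x)"
      using f_nonneg[OF i, of y] by linarith
    moreover have "\<mu>\<^sub>f / 2 * (norm (x - c))\<^sup>2 \<le> - f i x + grad (f i) x \<bullet> (x - c)"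
      using bregman_ge_if_strongly_convex[OF f_diff f_sc(2), OF i i, of c x] c[OF i]
      by (simp add: bregman_def norm_minus_commute inner_diff_right)
    \<comment> \<open>The values \<open>f i x\<close> cancel, and the directions
      \<open>y - x\<close> and \<open>x - c\<close> add up to \<open>y - c\<close>.\<close>
    ultimately have "\<mu>\<^sub>f / 2 * (norm (x - c))\<^sup>2 \<le> L i / 2 * (norm (y - x))\<^sup>2 + grad (f i) x \<bullet> (y - c)"
      by (simp add: inner_diff_right)
    then have "t * (\<mu>\<^sub>f / 2 * (norm (x - c))\<^sup>2)
        \<le> (t * L i) / 2 * (norm (y - x))\<^sup>2 + t * (grad (f i) x \<bullet> (y - c))"
      using mult_left_mono[OF _ t(1)] by (fastforce simp: algebra_simps)
    also have "(t * L i) / 2 * (norm (y - x))\<^sup>2 \<le> \<mu> / 2 * (norm (y - x))\<^sup>2"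
      using t(2)[OF i] by (intro mult_right_mono) auto
    finally show ?thesis by simp
  qed
  have "t * (\<mu>\<^sub>f / 2 * (norm (x - c))\<^sup>2) = (\<Sum>i\<in>I. w i * (t * (\<mu>\<^sub>f / 2 * (norm (x - c))\<^sup>2)))"
    by (simp only: sum_distrib_right[symmetric] w mult_1)
  also have "\<dots> \<le> (\<Sum>i\<in>I. w i * (\<mu> / 2 * (norm (y - x))\<^sup>2 + t * (grad (f i) x \<bullet> (y - c))))"
    by (intro sum_mono mult_left_mono term_ge w)
  also have "\<dots> = (\<Sum>i\<in>I. w i) * (\<mu> / 2 * (norm (y - x))\<^sup>2) + t * (?g \<bullet> (y - c))"
    by (simp add: distrib_left sum.distrib sum_distrib_right sum_distrib_left inner_sum_left mult_ac)
  also have "\<dots> \<le> bregman \<psi> x y + t * (?g \<bullet> (y - c))"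
    using bregman_ge_if_strongly_convex[OF psi(2,1), of y x] w(2) by simp
  \<comment> \<open>By \<open>step\<close>, the difference of the gradients of \<psi> at
    \<open>x\<close> and \<open>y\<close> is \<open>t *\<^sub>R ?g\<close>.\<close>
  also have "\<dots> = bregman \<psi> x c - bregman \<psi> y c"
    by (simp add: bregman_three_point step)
  finally have decrease: "t * (\<mu>\<^sub>f / 2 * (norm (x - c))\<^sup>2) \<le> bregman \<psi> x c - bregman \<psi> y c" .
  \<comment> \<open>The upper quadratic bound on the Bregman distance turns the additive decrease
    into a multiplicative one.\<close>
  have "\<mu>\<^sub>f / L\<^sub>\<psi> * t * bregman \<psi> x c \<le> \<mu>\<^sub>f / L\<^sub>\<psi> * t * (L\<^sub>\<psi> / 2 * (norm (c - x))\<^sup>2)"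
    using bregman_le_if_lipschitz_grad[OF psi(2) psi_lip(1)] psi_lip(2) t(1) f_sc(1)
    by (intro mult_left_mono) auto
  also have "\<dots> = t * (\<mu>\<^sub>f / 2 * (norm (x - c))\<^sup>2)"
    using psi_lip(2) by (simp add: norm_minus_commute)
  finally show ?thesis
    unfolding left_diff_distrib using decrease by linarith
qed

section \<open>Limits of contractions and the bilevel solution\<close>

text \<open>The sequence decreases to some limit \<open>l\<close>. If \<open>l\<close> were
  positive, each step would lose at least \<open>\<alpha> * l * t k\<close>, and telescoping would
  bound the partial sums of \<open>t\<close> by \<open>a 0 / (\<alpha> * l)\<close>.\<close>

lemma tendsto_zero_if_contraction_not_summable:
  fixes a t :: "nat \<Rightarrow> real"
  assumes a: "\<And>k. a k \<ge> 0" and t: "\<And>k. t k \<ge> 0" and \<alpha>: "\<alpha> > 0"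
    and step: "\<And>k. a (Suc k) \<le> (1 - \<alpha> * t k) * a k" and "\<not> summable t"
  shows "a \<longlonglongrightarrow> 0"
proof -
  have dec: "\<alpha> * t k * a k \<le> a k - a (Suc k)" for k
    using step[of k] by (simp add: algebra_simps)
  have "a (Suc k) \<le> a k" for k
    using dec[of k] a[of k] t[of k] \<alpha> by (smt (verit) mult_nonneg_nonneg)
  then have "decseq a" by (rule decseq_SucI)
  then obtain l where l: "a \<longlonglongrightarrow> l" "\<And>k. l \<le> a k"
    using decseq_convergent[of a 0] a by auto
  have "l \<ge> 0" using l(1) a by (intro LIMSEQ_le_const) auto
  moreover have "\<not> l > 0"
  proof
    assume "l > 0"
    have "(\<Sum>k<n. t k) \<le> a 0 / (\<alpha> * l)" for n
    proof -
      have "\<alpha> * l * (\<Sum>k<n. t k) \<le> (\<Sum>k<n. a k - a (Suc k))"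
        unfolding sum_distrib_left
      proof (rule sum_mono)
        fix k
        have "\<alpha> * l * t k \<le> \<alpha> * t k * a k"
          using mult_left_mono[OF l(2)[of k], of "\<alpha> * t k"] \<alpha> t[of k] by (simp add: mult_ac)
        with dec[of k] show "\<alpha> * l * t k \<le> a k - a (Suc k)" by linarith
      qed
      also have "\<dots> \<le> a 0"
        using a[of n] by (simp add: sum_lessThan_telescope')
      finally show ?thesis
        using \<alpha> \<open>l > 0\<close> by (simp add: field_simps)
    qed
    then have "summable t"
      using t by (intro summableI_nonneg_bounded) auto
    with \<open>\<not> summable t\<close> show False ..
  qed
  ultimately show ?thesis using l(1) by simp
qed

text \<open>The nonnegative objective vanishes at \<open>c\<close>. Any other zero would be a zero
  of every \<open>f i\<close>, since the weights are positive, and a strongly convex function has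
  only one minimiser. The feasible set is thus a singleton.\<close>

lemma bilevel_solution_iff_eq_common_zero:
  fixes f :: "'i \<Rightarrow> 'a::euclidean_space \<Rightarrow> real"
  assumes "finite I" "I \<noteq> {}"
    and f: "\<And>i z. i \<in> I \<Longrightarrow> f i differentiable (at z)"
      "\<And>i z. i \<in> I \<Longrightarrow> f i z \<ge> 0" "\<And>i. i \<in> I \<Longrightarrow> strongly_convex \<mu> (f i)" "\<mu> > 0"
    and P: "\<And>i. i \<in> I \<Longrightarrow> P i > 0"
    and c: "\<And>i. i \<in> I \<Longrightarrow> f i c = 0"
  shows "bilevel_solution \<psi> (\<lambda>z. \<Sum>i\<in>I. P i * f i z) z \<longleftrightarrow> z = c"
proof -
  let ?F = "\<lambda>z. \<Sum>i\<in>I. P i * f i z"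
  have zero: "z = c" if i: "i \<in> I" and "f i z = 0" for i z
  proof -
    \<comment> \<open>As a global minimiser, \<open>c\<close> has 0 as a subgradient, so the linear
      term of the Bregman distance based at \<open>c\<close> vanishes.\<close>
    have "f i c + 0 \<bullet> (v - c) \<le> f i v" for v using c[OF i] f(2)[OF i] by simp
    then have "grad (f i) c = 0"
      using f(1)[OF i] by (intro subdifferential_eq_grad) (auto simp: subdifferential_def)
    then have "\<mu> / 2 * (norm (z - c))\<^sup>2 \<le> 0"
      using bregman_ge_if_strongly_convex[OF f(1,3), OF i i, of z c] c[OF i] that
      by (simp add: bregman_def)
    then show ?thesis
      using \<open>\<mu> > 0\<close> by (simp add: mult_le_0_iff)
  qed
  have nonneg: "?F z \<ge> 0" for z
    using f(2) P by (intro sum_nonneg mult_nonneg_nonneg) (auto intro: less_imp_le)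
  have Fc: "?F c = 0" by (simp add: c)
  have Fz: "z = c" if "?F z \<le> 0" for z
  proof -
    have "?F z = 0" using that nonneg[of z] by linarith
    then have "\<forall>i\<in>I. P i * f i z = 0"
      using f(2) P \<open>finite I\<close> by (subst (asm) sum_nonneg_eq_0_iff) (auto simp: less_imp_le)
    moreover obtain i where "i \<in> I" using \<open>I \<noteq> {}\<close> by blast
    ultimately have "f i z = 0" using P by (metis less_irrefl mult_eq_0_iff)
    with \<open>i \<in> I\<close> show ?thesis by (rule zero)
  qed
  have "argmin_set ?F = {c}"
  proof (intro set_eqI iffI)
    fix z assume "z \<in> argmin_set ?F"
    then have "\<not> ?F c < ?F z" by (simp add: argmin_set_def is_arg_min_def)
    with Fc Fz show "z \<in> {c}" by simp
  next
    fix z assume "z \<in> {c}"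
    then show "z \<in> argmin_set ?F"
      using nonneg Fc by (simp add: argmin_set_def is_arg_min_def not_less)
  qed
  then show ?thesis
    by (auto simp: bilevel_solution_def is_arg_min_def)
qed

text \<open>Integrability is part of the conclusion because the integral of a non-integrable
  function defaults to 0. Factors below 1 alone do not force a zero limit when the stepsizes shrink,
  so convergence is stated for non-summable \<open>t\<close>, and a geometric rate for
  \<open>t\<close> bounded away from 0.\<close>

theorem proposition1:
  fixes m :: nat
    and C :: "nat \<Rightarrow> (real ^ 'n) set"
    and \<psi> :: "real ^ 'n \<Rightarrow> real"
    and f :: "nat \<Rightarrow> real ^ 'n \<Rightarrow> real"
    and F :: "real ^ 'n \<Rightarrow> real"
    and L P :: "nat \<Rightarrow> real"
    and \<mu> \<mu>\<^sub>f L\<^sub>\<psi> L\<^sub>m\<^sub>a\<^sub>x :: real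
    and M :: "'w measure"
    and S :: "nat set pmf"
    and J :: "nat \<Rightarrow> 'w \<Rightarrow> nat set"
    and w :: "nat \<Rightarrow> 'w \<Rightarrow> nat \<Rightarrow> real"
    and t :: "nat \<Rightarrow> real"
    and x\<^sub>0 xs\<^sub>0 :: "real ^ 'n"
    and x xs :: "nat \<Rightarrow> 'w \<Rightarrow> real ^ 'n"
  assumes C: "\<forall>i\<in>{1..m}. closed (C i) \<and> convex (C i)" "(\<Inter>i\<in>{1..m}. C i) \<noteq> {}"
    and psi: "\<mu> > 0" "strongly_convex \<mu> \<psi>"
    and psi_smooth: "\<forall>z. \<psi> differentiable (at z)" "L\<^sub>\<psi>-lipschitz_on UNIV (grad \<psi>)"
    and f_convex: "\<forall>i\<in>{1..m}. convex_on UNIV (f i)"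
    and f_smooth: "\<forall>i\<in>{1..m}. \<forall>z. f i differentiable (at z)"
      "\<forall>i\<in>{1..m}. L i > 0 \<and> (L i)-lipschitz_on UNIV (grad (f i))"
    and f_zero: "\<forall>i\<in>{1..m}. \<forall>z. f i z \<ge> 0 \<and> (f i z = 0 \<longleftrightarrow> z \<in> C i)"
    and f_strong: "\<mu>\<^sub>f > 0" "\<forall>i\<in>{1..m}. strongly_convex \<mu>\<^sub>f (f i)"
    and Lmax: "L\<^sub>m\<^sub>a\<^sub>x = Max (L ` {1..m})"
    and P: "\<forall>i\<in>{1..m}. P i > 0" "(\<Sum>i=1..m. P i) = 1"
    and F: "F = (\<lambda>z. \<Sum>i=1..m. P i * f i z)" "argmin_set F \<noteq> {}"
    and M: "prob_space M"
    and J: "\<forall>k. J k \<in> M \<rightarrow>\<^sub>M count_space UNIV"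
      "\<forall>k. distr M (count_space UNIV) (J k) = measure_pmf S"
      "\<forall>k. \<forall>\<omega>\<in>space M. J k \<omega> \<noteq> {} \<and> J k \<omega> \<subseteq> {1..m}"
    and w: "\<forall>k. \<forall>i\<in>{1..m}. (\<lambda>\<omega>. w k \<omega> i) \<in> borel_measurable M"
      "\<forall>k. \<forall>\<omega>\<in>space M. (\<forall>i\<in>J k \<omega>. w k \<omega> i > 0) \<and> (\<Sum>i\<in>J k \<omega>. w k \<omega> i) = 1"
    and t: "\<forall>k. 0 < t k \<and> t k \<le> \<mu> / L\<^sub>m\<^sub>a\<^sub>x"
    and init: "xs\<^sub>0 \<in> subdifferential \<psi> x\<^sub>0"
      "\<forall>\<omega>\<in>space M. x 0 \<omega> = x\<^sub>0 \<and> xs 0 \<omega> = xs\<^sub>0"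
    and dual_step: "\<forall>k. \<forall>\<omega>\<in>space M.
      xs (Suc k) \<omega> = xs k \<omega> - t k *\<^sub>R (\<Sum>i\<in>J k \<omega>. w k \<omega> i *\<^sub>R grad (f i) (x k \<omega>))"
    and primal_step: "\<forall>k. \<forall>\<omega>\<in>space M.
      x (Suc k) \<omega> = grad (fenchel_conjugate \<psi>) (xs (Suc k) \<omega>)"
  shows "(\<exists>!z. bilevel_solution \<psi> F z) \<and>
    (\<forall>xhat. bilevel_solution \<psi> F xhat \<longrightarrow>
      (\<forall>k. integrable M (\<lambda>\<omega>. bregman \<psi> (x k \<omega>) xhat)) \<and>
      (\<forall>k. integrable M (\<lambda>\<omega>. (norm (x k \<omega> - xhat))\<^sup>2)) \<and>
      (\<forall>k. (\<integral>\<omega>. bregman \<psi> (x (Suc k) \<omega>) xhat \<partial>M)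
             \<le> (1 - \<mu>\<^sub>f / L\<^sub>\<psi> * t k) * (\<integral>\<omega>. bregman \<psi> (x k \<omega>) xhat \<partial>M)) \<and>
      (\<forall>k. 0 \<le> 1 - \<mu>\<^sub>f / L\<^sub>\<psi> * t k \<and> 1 - \<mu>\<^sub>f / L\<^sub>\<psi> * t k < 1) \<and>
      (\<not> summable t \<longrightarrow>
         (\<lambda>k. \<integral>\<omega>. bregman \<psi> (x k \<omega>) xhat \<partial>M) \<longlonglongrightarrow> 0 \<and>
         (\<lambda>k. \<integral>\<omega>. (norm (x k \<omega> - xhat))\<^sup>2 \<partial>M) \<longlonglongrightarrow> 0) \<and>
      (\<forall>\<tau>>0. (\<forall>k. \<tau> \<le> t k) \<longrightarrow>
         (\<forall>k. (\<integral>\<omega>. bregman \<psi> (x k \<omega>) xhat \<partial>M)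
                \<le> (1 - \<mu>\<^sub>f / L\<^sub>\<psi> * \<tau>) ^ k * bregman \<psi> x\<^sub>0 xhat)))"
proof -
  interpret prob_space M by (rule M)
  define I where "I = {1..m}"
  let ?D = "\<lambda>k \<omega>. bregman \<psi> (x k \<omega>)"
  \<comment> \<open>For \<open>m = 0\<close> the probabilities would sum to 0 instead of 1.\<close>
  have I: "finite I" "I \<noteq> {}" using P(2) by (cases m; auto simp: I_def)+
  obtain c where c: "c \<in> (\<Inter>i\<in>{1..m}. C i)" using C(2) by blast
  then have fc: "f i c = 0" if "i \<in> I" for i using f_zero that by (auto simp: I_def)
  have f: "f i differentiable (at z)" "(L i)-lipschitz_on UNIV (grad (f i))"
    "strongly_convex \<mu>\<^sub>f (f i)" "f i z \<ge> 0" "L i > 0" if "i \<in> I" for i z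
    using that f_smooth f_strong f_zero by (auto simp: I_def)
  have diff: "\<psi> differentiable (at z)" for z using psi_smooth by blast
  have sol: "bilevel_solution \<psi> F z \<longleftrightarrow> z = c" for z
    unfolding F(1) I_def[symmetric]
    by (rule bilevel_solution_iff_eq_common_zero[OF I f(1,4,3) f_strong(1) _ fc])
      (use P in \<open>auto simp: I_def\<close>)
  have "\<mu> \<le> L\<^sub>\<psi>" by (rule modulus_le_lipschitz_constant[OF diff psi_smooth(2) psi(2)])
  with psi(1) have L\<psi>: "L\<^sub>\<psi> > 0" by linarith
  have Lle: "L i \<le> L\<^sub>m\<^sub>a\<^sub>x" if "i \<in> I" for i
    unfolding Lmax using that by (intro Max_ge) (auto simp: I_def)
  obtain i\<^sub>0 where i\<^sub>0: "i\<^sub>0 \<in> I" using I by blast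
  have "\<mu>\<^sub>f \<le> L i\<^sub>0" by (rule modulus_le_lipschitz_constant[OF f(1,2,3)[OF i\<^sub>0]])
  with Lle[OF i\<^sub>0] have "\<mu>\<^sub>f \<le> L\<^sub>m\<^sub>a\<^sub>x" by linarith
  then have Lmax_pos: "L\<^sub>m\<^sub>a\<^sub>x > 0" using f_strong(1) by linarith
  have tL: "t k * L\<^sub>m\<^sub>a\<^sub>x \<le> \<mu>" and tpos: "t k > 0" for k
    using t Lmax_pos by (auto simp: pos_le_divide_eq)
  define q where "q k = 1 - \<mu>\<^sub>f / L\<^sub>\<psi> * t k" for k
  have q: "0 \<le> q k" "q k < 1" for k
  proof -
    \<comment> \<open>The stepsize bound and the two comparisons of moduli with Lipschitz constants
      chain to \<open>\<mu>\<^sub>f * t k \<le> L\<^sub>\<psi>\<close>.\<close>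
    have "\<mu>\<^sub>f * t k \<le> L\<^sub>m\<^sub>a\<^sub>x * t k"
      using \<open>\<mu>\<^sub>f \<le> L\<^sub>m\<^sub>a\<^sub>x\<close> tpos[of k] by (intro mult_right_mono) auto
    also have "\<dots> \<le> L\<^sub>\<psi>" using tL[of k] \<open>\<mu> \<le> L\<^sub>\<psi>\<close> by (simp add: mult.commute)
    finally show "0 \<le> q k" using L\<psi> by (simp add: q_def field_simps)
    show "q k < 1" using L\<psi> f_strong(1) tpos[of k] by (simp add: q_def)
  qed
  \<comment> \<open>A case split replaces induction: each successor iterate is itself an image under
    the gradient of the conjugate.\<close>
  have mirror: "grad \<psi> (x k \<omega>) = xs k \<omega>" if "\<omega> \<in> space M" for k \<omega>
  proof (cases k)
    case 0
    then show ?thesis using subdifferential_eq_grad[OF diff init(1)] init(2) that by simp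
  next
    case (Suc j)
    then show ?thesis
      using grad_grad_fenchel_conjugate[OF psi diff] primal_step that by simp
  qed
  have contract: "?D (Suc k) \<omega> c \<le> q k * ?D k \<omega> c" if \<omega>: "\<omega> \<in> space M" for k \<omega>
    unfolding q_def
  proof (rule bregman_projection_step[OF psi(2) diff psi_smooth(2) L\<psi>,
        where I = "J k \<omega>" and f = f and w = "w k \<omega>" and L = L])
    show "t k * L i \<le> \<mu>" if "i \<in> J k \<omega>" for i
    proof -
      have "i \<in> I" using that J(3) \<omega> unfolding I_def by blast
      then have "t k * L i \<le> t k * L\<^sub>m\<^sub>a\<^sub>x" using Lle tpos[of k] by simp
      with tL[of k] show ?thesis by linarith
    qed
    show "grad \<psi> (x (Suc k) \<omega>) = grad \<psi> (x k \<omega>) - t k *\<^sub>R (\<Sum>i\<in>J k \<omega>. w k \<omega> i *\<^sub>R grad (f i) (x k \<omega>))"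
      using mirror[OF \<omega>] dual_step \<omega> by simp
    show "w k \<omega> i \<ge> 0" if "i \<in> J k \<omega>" for i using w(2) \<omega> that by (auto intro: less_imp_le)
    have "J k \<omega> \<subseteq> I" using J(3) \<omega> by (simp add: I_def)
    then show "f i differentiable (at z)" "(L i)-lipschitz_on UNIV (grad (f i))"
      "strongly_convex \<mu>\<^sub>f (f i)" "f i z \<ge> 0" "f i c = 0" if "i \<in> J k \<omega>" for i z
      using f fc that by blast+
  qed (use w(2) \<omega> f_strong(1) tpos[of k] in auto)
  have norm_le: "(norm (z - c))\<^sup>2 \<le> 2 / \<mu> * bregman \<psi> z c" for z
    using bregman_ge_if_strongly_convex[OF diff psi(2), of c z] psi(1)
    by (simp add: field_simps norm_minus_commute)
  have Dnn: "0 \<le> bregman \<psi> z c" for z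
    by (rule order_trans[OF _ bregman_ge_if_strongly_convex[OF diff psi(2)]]) (use psi(1) in simp)
  \<comment> \<open>The bound is uniform in \<omega>, which yields integrability on a probability
    space.\<close>
  have bound: "?D k \<omega> c \<le> bregman \<psi> x\<^sub>0 c" if \<omega>: "\<omega> \<in> space M" for k \<omega>
  proof (induction k)
    case 0
    then show ?case using init(2) \<omega> by simp
  next
    case (Suc k)
    have "q k * ?D k \<omega> c \<le> 1 * ?D k \<omega> c"
      using q[of k] Dnn by (intro mult_right_mono) auto
    with contract[OF \<omega>, of k] Suc show ?case by linarith
  qed

  \<comment> \<open>Measurability and integrability of the iterates\<close>
  have meas: "x k \<in> borel_measurable M \<and> xs k \<in> borel_measurable M" for k
  proof (induction k)
    case 0
    have "x 0 \<in> borel_measurable M \<longleftrightarrow> (\<lambda>\<omega>. x\<^sub>0) \<in> borel_measurable M"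
      and "xs 0 \<in> borel_measurable M \<longleftrightarrow> (\<lambda>\<omega>. xs\<^sub>0) \<in> borel_measurable M"
      by (rule measurable_cong; use init(2) in simp)+
    then show ?case by simp
  next
    case (Suc k)
    \<comment> \<open>The sum over the random set \<open>J k \<omega>\<close> becomes a sum over the
      fixed set \<open>I\<close> with weights cut to 0 outside the block, so that measurability can
      be checked term by term.\<close>
    let ?s = "\<lambda>\<omega>. xs k \<omega> - t k *\<^sub>R (\<Sum>i\<in>I. (if i \<in> J k \<omega> then w k \<omega> i else 0) *\<^sub>R grad (f i) (x k \<omega>))"
    have "xs (Suc k) \<omega> = ?s \<omega>" if \<omega>: "\<omega> \<in> space M" for \<omega>
    proof -
      have "J k \<omega> \<subseteq> I" using J(3) \<omega> by (simp add: I_def)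
      then have "(\<Sum>i\<in>J k \<omega>. w k \<omega> i *\<^sub>R grad (f i) (x k \<omega>))
          = (\<Sum>i\<in>I. (if i \<in> J k \<omega> then w k \<omega> i else 0) *\<^sub>R grad (f i) (x k \<omega>))"
        using I(1) by (intro sum.mono_neutral_cong_left) auto
      then show ?thesis using dual_step \<omega> by simp
    qed
    then have xs_eq: "xs (Suc k) \<in> borel_measurable M \<longleftrightarrow> ?s \<in> borel_measurable M"
      by (intro measurable_cong)
    have "(\<lambda>\<omega>. (if i \<in> J k \<omega> then w k \<omega> i else 0) *\<^sub>R grad (f i) (x k \<omega>)) \<in> borel_measurable M"
      if "i \<in> I" for i
    proof (intro borel_measurable_scaleR measurable_If)
      have "J k -` {s. i \<in> s} \<inter> space M \<in> sets M"
        using J(1) by (intro measurable_sets[of "J k" M "count_space UNIV"]) auto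
      also have "J k -` {s. i \<in> s} \<inter> space M = {\<omega> \<in> space M. i \<in> J k \<omega>}" by auto
      finally show "{\<omega> \<in> space M. i \<in> J k \<omega>} \<in> sets M" .
      have "continuous_on UNIV (grad (f i))"
        using f(2)[OF that] by (rule lipschitz_on_continuous_on)
      then show "(\<lambda>\<omega>. grad (f i) (x k \<omega>)) \<in> borel_measurable M"
        by (rule borel_measurable_continuous_on[OF _ conjunct1[OF Suc.IH]])
      show "(\<lambda>\<omega>. w k \<omega> i) \<in> borel_measurable M" using w(1) that unfolding I_def by blast
    qed simp
    then have "(\<lambda>\<omega>. \<Sum>i\<in>I. (if i \<in> J k \<omega> then w k \<omega> i else 0) *\<^sub>R grad (f i) (x k \<omega>)) \<in> borel_measurable M"
      by (rule borel_measurable_sum)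
    then have xs_meas: "xs (Suc k) \<in> borel_measurable M"
      unfolding xs_eq
      by (intro borel_measurable_diff borel_measurable_scaleR borel_measurable_const conjunct2[OF Suc.IH])
    have "continuous_on UNIV (grad (fenchel_conjugate \<psi>))"
      using lipschitz_grad_fenchel_conjugate[OF psi diff] by (rule lipschitz_on_continuous_on)
    then have "(\<lambda>\<omega>. grad (fenchel_conjugate \<psi>) (xs (Suc k) \<omega>)) \<in> borel_measurable M"
      using xs_meas by (rule borel_measurable_continuous_on)
    moreover have "x (Suc k) \<in> borel_measurable M
        \<longleftrightarrow> (\<lambda>\<omega>. grad (fenchel_conjugate \<psi>) (xs (Suc k) \<omega>)) \<in> borel_measurable M"
      by (rule measurable_cong) (use primal_step in blast)
    ultimately show ?case using xs_meas by blast
  qed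
  have "continuous_on UNIV \<psi>"
    using diff by (simp add: continuous_on_eq_continuous_at differentiable_imp_continuous_within)
  moreover have "continuous_on UNIV (grad \<psi>)"
    using psi_smooth(2) by (rule lipschitz_on_continuous_on)
  ultimately have "continuous_on UNIV (\<lambda>z. bregman \<psi> z c)"
    unfolding bregman_def by (intro continuous_intros)
  then have D_meas: "(\<lambda>\<omega>. ?D k \<omega> c) \<in> borel_measurable M" for k
    by (rule borel_measurable_continuous_on[OF _ conjunct1[OF meas]])
  have D_int: "integrable M (\<lambda>\<omega>. ?D k \<omega> c)" for k
    using bound Dnn D_meas
    by (intro integrable_const_bound[of _ "bregman \<psi> x\<^sub>0 c"] AE_I2) auto
  have N_int: "integrable M (\<lambda>\<omega>. (norm (x k \<omega> - c))\<^sup>2)" for k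
  proof (rule Bochner_Integration.integrable_bound)
    show "integrable M (\<lambda>\<omega>. 2 / \<mu> * ?D k \<omega> c)" using D_int by simp
    show "(\<lambda>\<omega>. (norm (x k \<omega> - c))\<^sup>2) \<in> borel_measurable M"
      by (rule borel_measurable_continuous_on[OF _ conjunct1[OF meas]]) (intro continuous_intros)
    show "AE \<omega> in M. norm ((norm (x k \<omega> - c))\<^sup>2) \<le> norm (2 / \<mu> * ?D k \<omega> c)"
      using order_trans[OF norm_le abs_ge_self] by (intro AE_I2) (simp add: abs_mult)
  qed

  \<comment> \<open>Passage to expectations\<close>
  define a where "a k = (\<integral>\<omega>. ?D k \<omega> c \<partial>M)" for k
  have a_nonneg: "0 \<le> a k" for k
    unfolding a_def using Dnn by simp
  have a_step: "a (Suc k) \<le> q k * a k" for k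
  proof -
    \<comment> \<open>The stepsize does not depend on \<omega>, so the factor \<open>q k\<close> can
      leave the integral.\<close>
    have "a (Suc k) \<le> (\<integral>\<omega>. q k * ?D k \<omega> c \<partial>M)"
      unfolding a_def using D_int contract by (intro integral_mono) auto
    then show ?thesis by (simp add: a_def)
  qed
  have lim: "a \<longlonglongrightarrow> 0" "(\<lambda>k. \<integral>\<omega>. (norm (x k \<omega> - c))\<^sup>2 \<partial>M) \<longlonglongrightarrow> 0" if "\<not> summable t"
  proof -
    show lim_a: "a \<longlonglongrightarrow> 0"
      by (rule tendsto_zero_if_contraction_not_summable[OF a_nonneg less_imp_le[OF tpos] _ a_step[unfolded q_def] that])
        (use L\<psi> f_strong(1) in simp)
    have "(\<integral>\<omega>. (norm (x k \<omega> - c))\<^sup>2 \<partial>M) \<le> 2 / \<mu> * a k" for k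
    proof -
      have "(\<integral>\<omega>. (norm (x k \<omega> - c))\<^sup>2 \<partial>M) \<le> (\<integral>\<omega>. 2 / \<mu> * ?D k \<omega> c \<partial>M)"
        using N_int D_int norm_le by (intro integral_mono) auto
      then show ?thesis by (simp add: a_def)
    qed
    then have "norm (\<integral>\<omega>. (norm (x k \<omega> - c))\<^sup>2 \<partial>M) \<le> 2 / \<mu> * a k" for k
      by simp
    moreover have "(\<lambda>k. 2 / \<mu> * a k) \<longlonglongrightarrow> 0"
      using tendsto_mult_left[OF lim_a, of "2 / \<mu>"] by simp
    ultimately show "(\<lambda>k. \<integral>\<omega>. (norm (x k \<omega> - c))\<^sup>2 \<partial>M) \<longlonglongrightarrow> 0"
      by (rule Lim_null_comparison[OF always_eventually[OF allI]])
  qed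
  have rate: "a k \<le> (1 - \<mu>\<^sub>f / L\<^sub>\<psi> * \<tau>) ^ k * bregman \<psi> x\<^sub>0 c" if \<tau>: "\<forall>k. \<tau> \<le> t k" for k \<tau>
  proof (induction k)
    case 0
    have "a 0 = (\<integral>\<omega>. bregman \<psi> x\<^sub>0 c \<partial>M)"
      unfolding a_def using init(2) by (intro Bochner_Integration.integral_cong) auto
    then show ?case by (simp add: prob_space)
  next
    case (Suc k)
    have le: "q k \<le> 1 - \<mu>\<^sub>f / L\<^sub>\<psi> * \<tau>"
      unfolding q_def using \<tau> L\<psi> f_strong(1) by (intro diff_left_mono mult_left_mono) auto
    then have "a (Suc k) \<le> (1 - \<mu>\<^sub>f / L\<^sub>\<psi> * \<tau>) * a k"
      using a_step[of k] mult_right_mono[OF le a_nonneg[of k]] by linarith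
    \<comment> \<open>The factor with \<tau> is nonnegative because it is at least
      \<open>q k\<close>.\<close>
    also have "\<dots> \<le> (1 - \<mu>\<^sub>f / L\<^sub>\<psi> * \<tau>) * ((1 - \<mu>\<^sub>f / L\<^sub>\<psi> * \<tau>) ^ k * bregman \<psi> x\<^sub>0 c)"
      using Suc q(1)[of k] le by (intro mult_left_mono) auto
    finally show ?case by simp
  qed
  show ?thesis
    unfolding sol using D_int N_int a_step q lim rate
    by (intro conjI allI impI ex1I[of _ c]) (simp_all add: a_def[abs_def] q_def)
qed

end
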